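(* Let $r$ be a positive integer. For every finite simple graph $G$ with $c_{r+1}(G)=0$ (i.e., $G$ has no clique on $r+1$ vertices), there is an $r$-colorable simplicial complex $C$ such that $c_i(C)=c_i(G)$ for all $i$.
   Context: For a finite simple graph $G$, $c_i(G)$ denotes the number of cliques of $G$ with exactly $i$ vertices (equivalently, the number of $i$-vertex faces of the clique complex of $G$, whose faces are the cliques of $G$; $c_0(G)=1$ counting the empty clique). A simplicial complex on a finite vertex set $V$ is a collection of subsets of $V$ containing every singleton and closed under taking subsets; $c_i(C)$ denotes the number of its faces with exactly $i$ vertices ($c_0(C)=1$). A simplicial complex is $r$-colorable if its 1-skeleton (the graph on $V$ whose edges are the 2-element faces) admits a proper vertex coloring with $r$ colors. *)

theory Defs
  imports "HOL-Library.Ramsey"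
begin

definition fin_simple_graph :: "'a set \<Rightarrow> 'a set set \<Rightarrow> bool" where
  "fin_simple_graph V E \<longleftrightarrow> finite V \<and> E \<subseteq> nsets V 2"

definition clique_count :: "nat \<Rightarrow> 'a set \<Rightarrow> 'a set set \<Rightarrow> nat" where
  "clique_count i V E = card {K \<in> nsets V i. clique K E}"

text \<open>
  The empty set is required to be a face even when there are no vertices.
\<close>
definition abstract_complex :: "'a set \<Rightarrow> 'a set set \<Rightarrow> bool" where
  "abstract_complex V C \<longleftrightarrow>
     finite V \<and> C \<subseteq> Pow V \<and> {} \<in> C \<and> (\<forall>v\<in>V. {v} \<in> C) \<and>
     (\<forall>F\<in>C. \<forall>F'. F' \<subseteq> F \<longrightarrow> F' \<in> C)"

definition face_count :: "nat \<Rightarrow> 'a set set \<Rightarrow> nat" where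
  "face_count i C = card {F \<in> C. card F = i}"

definition graph_colorable :: "nat \<Rightarrow> 'a set \<Rightarrow> 'a set set \<Rightarrow> bool" where
  "graph_colorable r V E \<longleftrightarrow>
     (\<exists>f :: 'a \<Rightarrow> nat. f \<in> V \<rightarrow> {..<r} \<and> (\<forall>u\<in>V. \<forall>v\<in>V. {u, v} \<in> E \<longrightarrow> f u \<noteq> f v))"

definition skeleton1_edges :: "'a set set \<Rightarrow> 'a set set" where
  "skeleton1_edges C = {F \<in> C. card F = 2}"

definition complex_colorable :: "nat \<Rightarrow> 'a set \<Rightarrow> 'a set set \<Rightarrow> bool" where
  "complex_colorable r V C \<longleftrightarrow> graph_colorable r V (skeleton1_edges C)"

end

(*
  A graph without a clique on r + 1 vertices is modelled by r-colored families of sets, one clique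
  size at a time. Take a vertex of maximal degree, counted in cliques of the given size, and split
  the cliques by their last vertex outside its neighborhood. All links that occur have no clique
  on r vertices, and their (r - 1)-colored models can be taken to be nested initial segments of
  the colexicographic order, so coning them over new vertices of one further color creates no
  superfluous faces. The models for different clique sizes fit together because, by the theorem
  of Frankl, Fueredi and Kalai, initial segments have the smallest shadows among r-colored families
  and their shadows are again initial segments.

  For the latter theorem, take a family of given size with smallest shadow and, among those, with
  the smallest sum of binary codes. By induction on the number of colors, replacing the links of the
  vertices of one color by initial segments does not enlarge the shadow, so the family is
  compressed in every color. If it is not an initial segment, trading its largest member for the
  smallest missing set enlarges the shadow only if every member uses every color, and then a
  whole run of members can be traded instead.
*)
theory Submission
  imports Defs "HOL-Library.Nat_Bijection"
begin

subsection \<open>The colexicographic order\<close>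

text \<open>The order on finite sets of naturals induced by \<^const>\<open>set_encode\<close> is the colexicographic order.\<close>

lemma set_encode_Un_disjoint:
  assumes "finite A" "finite B" "A \<inter> B = {}"
  shows "set_encode (A \<union> B) = set_encode A + set_encode B"
  using assms by (simp add: set_encode_def sum.union_disjoint)

lemma set_encode_mono: "finite B \<Longrightarrow> A \<subseteq> B \<Longrightarrow> set_encode A \<le> set_encode B"
  by (simp add: set_encode_def sum_mono2)

lemma set_encode_less_power:
  assumes "\<And>a. a \<in> A \<Longrightarrow> a < n"
  shows "set_encode A < 2 ^ n"
proof -
  have "set_encode A \<le> set_encode {..<n}"
    using assms by (intro set_encode_mono) auto
  also have "\<dots> < 2 ^ n"
    by (induction n) (simp_all add: set_encode_def lessThan_Suc)
  finally show ?thesis .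
qed

lemma power_le_set_encode: "finite A \<Longrightarrow> a \<in> A \<Longrightarrow> 2 ^ a \<le> set_encode A"
  using set_encode_mono[of A "{a}"] by (simp add: set_encode_def)

text \<open>The elements of \<open>A\<close> below \<open>d\<close> contribute less than
  \<open>2 ^ d\<close>, and those above \<open>d\<close> are matched by \<open>B\<close>.\<close>

lemma set_encode_lessI:
  assumes "finite A" "finite B" "d \<in> B" "d \<notin> A" and above: "\<And>v. v > d \<Longrightarrow> v \<in> A \<Longrightarrow> v \<in> B"
  shows "set_encode A < set_encode B"
proof -
  let ?H = "{v \<in> A. v > d}" and ?L = "{v \<in> A. v < d}"
  have "A = ?H \<union> ?L" using \<open>d \<notin> A\<close> nat_neq_iff by blast
  then have "set_encode A = set_encode ?H + set_encode ?L"
    using set_encode_Un_disjoint[of ?H ?L] \<open>finite A\<close> by fastforce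
  also have "\<dots> < set_encode ?H + 2 ^ d"
    using set_encode_less_power[of ?L d] by simp
  also have "\<dots> = set_encode (insert d ?H)"
    using \<open>finite A\<close> by simp
  also have "\<dots> \<le> set_encode B"
    using assms by (intro set_encode_mono) auto
  finally show ?thesis .
qed

text \<open>The witness is the largest element of the symmetric difference; were it in
  \<open>A\<close>, \<open>set_encode_lessI\<close> would reverse the inequality.\<close>

lemma set_encode_lessE:
  assumes "finite A" "finite B" "set_encode A < set_encode B"
  obtains d where "d \<in> B" "d \<notin> A" "\<And>v. v > d \<Longrightarrow> v \<in> A \<longleftrightarrow> v \<in> B"
proof -
  let ?D = "(A - B) \<union> (B - A)"
  define d where "d = Max ?D"
  have "finite ?D" "?D \<noteq> {}" using assms by auto
  then have "d \<in> ?D" unfolding d_def by (rule Max_in)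
  have above: "v \<in> A \<longleftrightarrow> v \<in> B" if "v > d" for v
    using Max_ge[OF \<open>finite ?D\<close>, of v] that unfolding d_def by fastforce
  have "d \<notin> A - B"
    using set_encode_lessI[of B A d] assms above by auto
  with \<open>d \<in> ?D\<close> above that show thesis by blast
qed

lemma set_encode_image_le:
  assumes "finite A" "inj_on f A" "\<And>a. a \<in> A \<Longrightarrow> f a \<le> a"
  shows "set_encode (f ` A) \<le> set_encode A"
  using assms by (simp add: set_encode_def sum.reindex sum_mono)

lemma set_encode_image_ge:
  assumes "finite A" "inj_on f A" "\<And>a. a \<in> A \<Longrightarrow> a \<le> f a"
  shows "set_encode A \<le> set_encode (f ` A)"
  using assms by (simp add: set_encode_def sum.reindex sum_mono)

section \<open>Initial segments\<close>

definition colex_init :: "nat set set \<Rightarrow> nat set set \<Rightarrow> bool" where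
  "colex_init X I \<longleftrightarrow> finite I \<and> I \<subseteq> X \<and>
     (\<forall>x\<in>I. \<forall>y\<in>X. set_encode y < set_encode x \<longrightarrow> y \<in> I)"

text \<open>Codes are injective on finite sets, so two initial segments of \<open>X\<close> are
  always nested and their sizes decide which way.\<close>

lemma colex_init_subset:
  assumes "colex_init X I" "colex_init X J" "card I \<le> card J" and fin: "\<And>x. x \<in> X \<Longrightarrow> finite x"
  shows "I \<subseteq> J"
proof (rule ccontr)
  assume "\<not> I \<subseteq> J"
  then obtain x where x: "x \<in> I" "x \<notin> J" by blast
  have "y \<in> I" if "y \<in> J" for y
  proof -
    have "x \<in> X" "y \<in> X" using that x assms(1,2) by (auto simp: colex_init_def)
    then have "set_encode y \<noteq> set_encode x"
      using set_encode_eq fin x that by blast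
    then show ?thesis
      using assms(1,2) that x \<open>x \<in> X\<close> \<open>y \<in> X\<close> unfolding colex_init_def by (meson linorder_neqE_nat)
  qed
  then have "J \<subset> I" using x by blast
  then have "card J < card I" using assms(1) by (simp add: colex_init_def psubset_card_mono)
  with assms(3) show False by simp
qed

text \<open>Among the subfamilies of \<open>X\<close> of the size of \<open>L\<close>, one of least
  code sum is an initial segment, since otherwise trading a member for a missing earlier set lowers
  the sum. The strict clause later certifies progress.\<close>

lemma colex_compress:
  assumes "finite L" "L \<subseteq> X"
  obtains I where "colex_init X I" "card I = card L" "sum set_encode I \<le> sum set_encode L"
    "\<not> colex_init X L \<Longrightarrow> sum set_encode I < sum set_encode L"
proof -
  let ?P = "\<lambda>I. finite I \<and> I \<subseteq> X \<and> card I = card L"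
  have swap: "\<exists>I'. ?P I' \<and> sum set_encode I' < sum set_encode I"
    if I: "?P I" "\<not> colex_init X I" for I
  proof -
    obtain x y where xy: "x \<in> I" "y \<in> X" "set_encode y < set_encode x" "y \<notin> I"
      using I unfolding colex_init_def by blast
    let ?I = "insert y (I - {x})"
    have "sum set_encode I = set_encode x + sum set_encode (I - {x})"
      using xy that by (simp add: sum.remove)
    then have "sum set_encode ?I < sum set_encode I"
      using xy that by simp
    moreover have "card ?I = card I"
      using xy I by (metis Diff_iff card_Suc_Diff1 card_insert_disjoint finite_Diff)
    then have "?P ?I" using xy I by auto
    ultimately show ?thesis by blast
  qed
  obtain I where I: "?P I" and least: "\<And>J. ?P J \<Longrightarrow> sum set_encode I \<le> sum set_encode J"
    using ex_has_least_nat[of ?P L "sum set_encode"] assms by blast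
  show thesis
  proof
    show "colex_init X I" using swap[OF I] least by (meson not_le)
    show "card I = card L" using I by simp
    show "sum set_encode I \<le> sum set_encode L" using least assms by blast
    show "sum set_encode I < sum set_encode L" if "\<not> colex_init X L"
      using swap[of L] least assms that by (meson le_less_trans)
  qed
qed

text \<open>Initial segments form a chain, so a finite nonempty union of them is just the largest
  one.\<close>

lemma card_UN_colex_init_le:
  assumes "finite Q" "\<And>q. q \<in> Q \<Longrightarrow> colex_init X (I q)" "\<And>x. x \<in> X \<Longrightarrow> finite x"
    and "\<And>q. q \<in> Q \<Longrightarrow> card (I q) \<le> b"
  shows "card (\<Union>q\<in>Q. I q) \<le> b"
proof (cases "Q = {}")
  case False
  let ?N = "(\<lambda>q. card (I q)) ` Q"
  have "Max ?N \<in> ?N" using \<open>finite Q\<close> False by (intro Max_in) auto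
  then obtain q where q: "q \<in> Q" "card (I q) = Max ?N" by auto
  then have "card (I p) \<le> card (I q)" if "p \<in> Q" for p
    using that \<open>finite Q\<close> by (metis Max_ge finite_imageI imageI)
  then have "(\<Union>q\<in>Q. I q) = I q"
    using colex_init_subset[OF _ _ _ assms(3)] assms(2) q(1) by (intro equalityI UN_least) blast+
  then show ?thesis using assms(4)[OF q(1)] by simp
qed simp

subsection \<open>Rainbow sets and shadows\<close>

text \<open>A vertex is a natural number and its color is its residue modulo \<open>m\<close>. Fixing \<open>m\<close>
  while the set \<open>R\<close> of admitted colors shrinks lets the link of a vertex keep the order
  of its vertices.\<close>

definition rainbow :: "nat \<Rightarrow> nat set \<Rightarrow> nat \<Rightarrow> nat set set" where
  "rainbow m R k = {S. finite S \<and> card S = k \<and> inj_on (\<lambda>v. v mod m) S \<and> (\<lambda>v. v mod m) ` S \<subseteq> R}"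

definition shadow :: "nat set set \<Rightarrow> nat set set" where
  "shadow F = (\<Union>S\<in>F. (\<lambda>e. S - {e}) ` S)"

lemma rainbow_finite: "S \<in> rainbow m R k \<Longrightarrow> finite S"
  by (simp add: rainbow_def)

lemma rainbow_init_subset:
  assumes "colex_init (rainbow m R k) I" "colex_init (rainbow m R k) J" "card I \<le> card J"
  shows "I \<subseteq> J"
  using colex_init_subset[OF assms] rainbow_finite by blast

lemma rainbow_card: "S \<in> rainbow m R k \<Longrightarrow> card S = k"
  by (simp add: rainbow_def)

lemma rainbow_color: "S \<in> rainbow m R k \<Longrightarrow> v \<in> S \<Longrightarrow> v mod m \<in> R"
  by (auto simp: rainbow_def)

lemma rainbow_unique: "S \<in> rainbow m R k \<Longrightarrow> v \<in> S \<Longrightarrow> w \<in> S \<Longrightarrow> v mod m = w mod m \<Longrightarrow> v = w"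
  by (auto simp: rainbow_def inj_on_def)

lemma rainbow_0 [simp]: "rainbow m R 0 = {{}}"
  by (auto simp: rainbow_def)

lemma rainbow_mono: "R \<subseteq> R' \<Longrightarrow> rainbow m R k \<subseteq> rainbow m R' k"
  by (auto simp: rainbow_def)

lemma rainbow_card_colors: "S \<in> rainbow m R k \<Longrightarrow> card ((\<lambda>v. v mod m) ` S) = k"
  by (simp add: rainbow_def card_image)

lemma rainbow_insert:
  assumes "S \<in> rainbow m R k" "v mod m \<in> R" "v mod m \<notin> (\<lambda>v. v mod m) ` S"
  shows "insert v S \<in> rainbow m R (Suc k)"
proof -
  have "v \<notin> S" using assms(3) by blast
  then show ?thesis using assms by (auto simp: rainbow_def)
qed

lemma rainbow_remove:
  assumes "S \<in> rainbow m R (Suc k)" "v \<in> S"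
  shows "S - {v} \<in> rainbow m (R - {v mod m}) k"
proof -
  have "inj_on (\<lambda>v. v mod m) (S - {v})"
    using assms by (auto simp: rainbow_def intro: inj_on_subset)
  then show ?thesis using assms by (auto simp: rainbow_def dest: inj_onD)
qed

lemma rainbow_remove': "S \<in> rainbow m R (Suc k) \<Longrightarrow> v \<in> S \<Longrightarrow> S - {v} \<in> rainbow m R k"
  using rainbow_remove[of S m R k v] rainbow_mono[of "R - {v mod m}" R m k] by blast

lemma shadowI: "insert e S \<in> F \<Longrightarrow> e \<notin> S \<Longrightarrow> S \<in> shadow F"
  unfolding shadow_def by (rule UN_I[of "insert e S"]) (auto simp: image_iff)

lemma shadowE:
  assumes "S \<in> shadow F"
  obtains e where "insert e S \<in> F" "e \<notin> S"
proof -
  obtain x e where "x \<in> F" "e \<in> x" "S = x - {e}"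
    using assms by (auto simp: shadow_def)
  then show thesis by (intro that[of e]) (auto simp: insert_absorb)
qed

lemma shadow_empty [simp]: "shadow {} = {}" "shadow {{}} = {}"
  by (simp_all add: shadow_def)

lemma shadow_Un: "shadow (F \<union> G) = shadow F \<union> shadow G"
  by (auto simp: shadow_def)

lemma shadow_subset: "F \<subseteq> rainbow m R (Suc k) \<Longrightarrow> shadow F \<subseteq> rainbow m R k"
  unfolding shadow_def using rainbow_remove' by blast

lemma finite_shadow:
  assumes "finite F" "F \<subseteq> rainbow m R k"
  shows "finite (shadow F)"
  using assms unfolding shadow_def by (intro finite_UN_I finite_imageI) (auto dest: rainbow_finite)

text \<open>Let \<open>insert e S\<close> be in \<open>I\<close> and let \<open>Z\<close> precede
  \<open>S\<close>. Either some vertex extends \<open>Z\<close> to a rainbow set preceding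
  \<open>insert e S\<close>, or \<open>Z\<close> is itself \<open>insert e S\<close> without one
  vertex. Vertices below \<open>m\<close> coincide with their colors, so the smallest vertex of a
  color \<open>f\<close> is \<open>f\<close>.\<close>

lemma colex_init_shadow:
  assumes R: "R \<subseteq> {..<m}" and I: "colex_init (rainbow m R (Suc k)) I"
  shows "colex_init (rainbow m R k) (shadow I)"
  unfolding colex_init_def
proof (intro conjI ballI impI)
  let ?col = "\<lambda>v::nat. v mod m"
  have I_sub: "I \<subseteq> rainbow m R (Suc k)" and "finite I" using I by (auto simp: colex_init_def)
  then show "finite (shadow I)" "shadow I \<subseteq> rainbow m R k"
    using finite_shadow shadow_subset by auto
  fix S Z assume "S \<in> shadow I" and Z: "Z \<in> rainbow m R k" and less: "set_encode Z < set_encode S"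
  then obtain e where x: "insert e S \<in> I" and e: "e \<notin> S" by (elim shadowE)
  let ?x = "insert e S"
  have xR: "?x \<in> rainbow m R (Suc k)" using x I_sub by blast
  have S: "S \<in> rainbow m R k" using rainbow_remove'[OF xR, of e] e by simp
  have [simp]: "finite S" "finite Z" using S Z by (auto dest: rainbow_finite)
  obtain d where d: "d \<in> S" "d \<notin> Z" and above: "\<And>v. v > d \<Longrightarrow> v \<in> Z \<longleftrightarrow> v \<in> S"
    using set_encode_lessE[OF _ _ less] by auto
  have extend: "Z \<in> shadow I"
    if "f \<in> R" "f \<notin> ?col ` Z" "set_encode (insert f Z) < set_encode ?x" for f
  proof -
    have fm: "f mod m = f" using that(1) R by auto
    have "f \<notin> Z" using that(2) fm by force
    moreover have "insert f Z \<in> rainbow m R (Suc k)"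
      using that fm by (intro rainbow_insert[OF Z]) auto
    then have "insert f Z \<in> I" using that(3) x I unfolding colex_init_def by blast
    ultimately show ?thesis by (intro shadowI)
  qed
  have lessd: "set_encode (insert f Z) < set_encode ?x" if "f < d" for f
    using that d above by (intro set_encode_lessI[of _ _ d]) auto
  have dR: "d mod m \<in> R" using S d rainbow_color by blast
  have "finite R" using R finite_subset by blast
  have "d mod m \<le> d" by simp
  \<comment> \<open>\<open>d\<close> is the largest vertex on which \<open>S\<close> and
    \<open>Z\<close> differ. The cases ask whether its color is free in \<open>Z\<close>, whether a
    smaller vertex has the same color, and on which side of \<open>d\<close> the vertex
    \<open>e\<close> lies.\<close>
  consider "?col d \<in> ?col ` Z" | "?col d \<notin> ?col ` Z" "d \<ge> m" | "?col d \<notin> ?col ` Z" "d < m" "e > d"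
    | "?col d \<notin> ?col ` Z" "d < m" "e < d"
    using d e by (metis linorder_neqE_nat not_le)
  then show "Z \<in> shadow I"
  proof cases
    case 1
    then obtain d' where d': "d' \<in> Z" "d mod m = d' mod m" by auto
    have "d' < d" using rainbow_unique[OF S \<open>d \<in> S\<close>, of d'] d' d above by (metis linorder_neqE_nat)
    then have "m \<le> d" using d'(2) by (metis mod_less not_le mod_less_eq_dividend)
    \<comment> \<open>\<open>Z\<close> has one vertex fewer than \<open>?x\<close>, so some color of
      \<open>R\<close> is free; its smallest vertex lies below \<open>m \<le> d\<close>.\<close>
    have "\<not> R \<subseteq> ?col ` Z"
    proof
      assume "R \<subseteq> ?col ` Z"
      then have "card (?col ` ?x) \<le> card (?col ` Z)"
        using rainbow_color[OF xR] by (intro card_mono) auto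
      then show False using rainbow_card_colors[OF Z] rainbow_card_colors[OF xR] by simp
    qed
    then obtain f where "f \<in> R" "f \<notin> ?col ` Z" by blast
    then show ?thesis using extend lessd R \<open>m \<le> d\<close> by (metis lessThan_iff order_less_le_trans subsetD)
  next
    case 2
    then have "d mod m < d" using dR R by (metis lessThan_iff order_less_le_trans subsetD)
    then show ?thesis using extend[OF dR] lessd 2 by auto
  next
    case 3
    then have "d mod m = d" by simp
    have "set_encode (insert d Z) < set_encode ?x"
      using 3 above e by (intro set_encode_lessI[of _ _ e]) auto
    then show ?thesis using extend[OF dR] 3 \<open>d mod m = d\<close> by auto
  next
    case 4
    show ?thesis
    proof (cases "\<exists>t\<in>?x. t < d \<and> ?col t \<notin> ?col ` Z")
      case True
      then obtain t where t: "t \<in> ?x" "t < d" "?col t \<notin> ?col ` Z" by blast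
      then have "?col t = t" using 4 by simp
      then show ?thesis using extend[of t] lessd[of t] t rainbow_color[OF xR, of t] by auto
    next
      \<comment> \<open>Every vertex of \<open>?x\<close> below \<open>d\<close> now has a color
        used by \<open>Z\<close>, which forces \<open>Z = ?x - {d}\<close>.\<close>
      case False
      have "t \<in> Z" if t: "t \<in> ?x" "t \<noteq> d" for t
      proof (cases "t > d")
        case True
        then show ?thesis using above t 4 by auto
      next
        case below: False
        then obtain z where z: "z \<in> Z" "?col t = ?col z" using False t by auto
        have "z = t"
        proof (cases "z < m")
          case True then show ?thesis using z(2) below 4 by simp
        next
          case False
          then have "z \<in> ?x" using above[of z] z 4 by auto
          then show ?thesis using rainbow_unique[OF xR] z t by metis
        qed
        then show ?thesis using z by simp
      qed
      then have "?x - {d} \<subseteq> Z" by blast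
      moreover have "card (?x - {d}) = card Z"
        using rainbow_card[OF rainbow_remove'[OF xR, of d]] rainbow_card[OF Z] d by simp
      ultimately have "?x - {d} = Z" by (simp add: card_subset_eq)
      moreover have "d \<in> ?x" using d by simp
      ultimately show ?thesis using x unfolding shadow_def by blast
    qed
  qed
qed

subsection \<open>Compression with respect to a color\<close>

text \<open>The decomposition of a family by a color: \<open>P0\<close> holds the members avoiding
  it, \<open>Q\<close> the vertices of that color, and \<open>P v\<close> the link of
  \<open>v\<close>.\<close>

definition glue :: "nat set set \<Rightarrow> nat set \<Rightarrow> (nat \<Rightarrow> nat set set) \<Rightarrow> nat set set" where
  "glue P0 Q P = P0 \<union> (\<Union>v\<in>Q. insert v ` P v)"

lemma rainbow_avoids: "T \<in> rainbow m (R - {c}) k \<Longrightarrow> v mod m = c \<Longrightarrow> v \<notin> T"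
  using rainbow_color by blast

text \<open>Every member has at most one vertex of color \<open>c\<close>, so the pieces are
  disjoint and all quantities add up. In the shadow, the faces without color \<open>c\<close> come
  from \<open>P0\<close> or by deleting some \<open>v\<close>; those containing \<open>v\<close>
  come from the shadow of its link.\<close>

lemma glue_props:
  assumes "finite Q" "\<forall>v\<in>Q. v mod m = c" and "c \<in> R"
    and P0: "finite P0" "P0 \<subseteq> rainbow m (R - {c}) (Suc k)"
    and "\<forall>v\<in>Q. finite (P v)" "\<forall>v\<in>Q. P v \<subseteq> rainbow m (R - {c}) k"
  shows "finite (glue P0 Q P)"
    and "glue P0 Q P \<subseteq> rainbow m R (Suc k)"
    and "card (glue P0 Q P) = card P0 + (\<Sum>v\<in>Q. card (P v))"
    and "sum set_encode (glue P0 Q P) =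
      sum set_encode P0 + (\<Sum>v\<in>Q. 2 ^ v * card (P v) + sum set_encode (P v))"
    and "card (shadow (glue P0 Q P)) =
      card (shadow P0 \<union> (\<Union>v\<in>Q. P v)) + (\<Sum>v\<in>Q. card (shadow (P v)))"
proof -
  have Q: "finite Q" "\<And>v. v \<in> Q \<Longrightarrow> v mod m = c"
    and P: "\<And>v. v \<in> Q \<Longrightarrow> finite (P v)" "\<And>v. v \<in> Q \<Longrightarrow> P v \<subseteq> rainbow m (R - {c}) k"
    using assms by auto
  \<comment> \<open>General in family and weight: it serves \<open>P\<close> with weights 1 and
    \<open>set_encode\<close>, and then the shadows of the links.\<close>
  have sum_ins: "sum f (A \<union> (\<Union>v\<in>Q. insert v ` B v)) = sum f A + (\<Sum>v\<in>Q. sum (\<lambda>T. f (insert v T)) (B v))"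
    if A: "finite A" "A \<subseteq> rainbow m (R - {c}) i" and B: "\<And>v. v \<in> Q \<Longrightarrow> finite (B v)"
      "\<And>v. v \<in> Q \<Longrightarrow> B v \<subseteq> rainbow m (R - {c}) j"
    for f :: "nat set \<Rightarrow> nat" and A B i j
  proof -
    have avB: "w \<notin> T" if "v \<in> Q" "w \<in> Q" "T \<in> B v" for v w T
      using rainbow_avoids[of T m R c j w] B(2) Q(2) that by blast
    have avA: "w \<notin> T" if "w \<in> Q" "T \<in> A" for w T
      using rainbow_avoids[of T m R c i w] A(2) Q(2) that by blast
    have "sum f (A \<union> (\<Union>v\<in>Q. insert v ` B v)) = sum f A + sum f (\<Union>v\<in>Q. insert v ` B v)"
      using A(1) Q(1) B(1) avA by (intro sum.union_disjoint) auto
    also have "sum f (\<Union>v\<in>Q. insert v ` B v) = (\<Sum>v\<in>Q. sum f (insert v ` B v))"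
    proof (intro sum.UNION_disjoint ballI impI)
      fix v w assume vw: "v \<in> Q" "w \<in> Q" "v \<noteq> w"
      have "insert v S \<noteq> insert w T" if "S \<in> B v" "T \<in> B w" for S T
        using avB[OF vw(2,1) that(2)] vw by blast
      then show "insert v ` B v \<inter> insert w ` B w = {}" by blast
    qed (use Q B in auto)
    also have "\<dots> = (\<Sum>v\<in>Q. sum (\<lambda>T. f (insert v T)) (B v))"
    proof (rule sum.cong[OF refl])
      fix v assume v: "v \<in> Q"
      have "inj_on (insert v) (B v)"
        using avB[OF v v] by (intro inj_onI) (metis insert_ident)
      then show "sum f (insert v ` B v) = sum (\<lambda>T. f (insert v T)) (B v)"
        by (simp add: sum.reindex)
    qed
    finally show ?thesis .
  qed
  show fin: "finite (glue P0 Q P)" using Q P P0 by (auto simp: glue_def)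
  show "card (glue P0 Q P) = card P0 + (\<Sum>v\<in>Q. card (P v))"
    using sum_ins[OF P0, where B = P and j = k and f = "\<lambda>_. 1"] P by (simp add: glue_def)
  have enc: "set_encode (insert v T) = 2 ^ v + set_encode T" if "v \<in> Q" "T \<in> P v" for v T
  proof (rule set_encode_insert)
    have T: "T \<in> rainbow m (R - {c}) k" using that P by blast
    show "finite T" using T by (rule rainbow_finite)
    show "v \<notin> T" using rainbow_avoids[OF T] Q(2) that by blast
  qed
  have "sum set_encode (glue P0 Q P) = sum set_encode P0 + (\<Sum>v\<in>Q. \<Sum>T\<in>P v. 2 ^ v + set_encode T)"
    unfolding glue_def using sum_ins[OF P0, where B = P and j = k and f = set_encode] P enc by simp
  then show "sum set_encode (glue P0 Q P) =
      sum set_encode P0 + (\<Sum>v\<in>Q. 2 ^ v * card (P v) + sum set_encode (P v))"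
    by (simp add: sum.distrib mult.commute)
  show sub: "glue P0 Q P \<subseteq> rainbow m R (Suc k)"
  proof -
    have "insert v T \<in> rainbow m R (Suc k)" if "v \<in> Q" "T \<in> P v" for v T
    proof (rule rainbow_insert)
      have T: "T \<in> rainbow m (R - {c}) k" using that P by blast
      then show "T \<in> rainbow m R k" using rainbow_mono[of "R - {c}" R] by blast
      show "v mod m \<in> R" "v mod m \<notin> (\<lambda>v. v mod m) ` T"
        using Q(2) that \<open>c \<in> R\<close> rainbow_color[OF T] by auto
    qed
    then show ?thesis using P0 rainbow_mono[of "R - {c}" R m "Suc k"] by (auto simp: glue_def)
  qed
  have shadow_link: "shadow (insert v ` P v) = P v \<union> insert v ` shadow (P v)" if v: "v \<in> Q" for v
  proof -
    have "v \<notin> T" if "T \<in> P v" for T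
      using rainbow_avoids[of T m R c k v] P(2) Q(2) v that by blast
    then have "(\<lambda>e. insert v T - {e}) ` insert v T = insert T (insert v ` (\<lambda>e. T - {e}) ` T)"
      if "T \<in> P v" for T
      using that by (auto simp: image_iff insert_Diff_if)
    then show ?thesis unfolding shadow_def by auto
  qed
  have "shadow (glue P0 Q P) = shadow P0 \<union> (\<Union>v\<in>Q. shadow (insert v ` P v))"
    by (auto simp: shadow_def glue_def)
  also have "\<dots> = (shadow P0 \<union> (\<Union>v\<in>Q. P v)) \<union> (\<Union>v\<in>Q. insert v ` shadow (P v))"
    using shadow_link by auto
  finally have sh: "shadow (glue P0 Q P) =
    (shadow P0 \<union> (\<Union>v\<in>Q. P v)) \<union> (\<Union>v\<in>Q. insert v ` shadow (P v))" .
  have base: "shadow P0 \<union> (\<Union>v\<in>Q. P v) \<subseteq> rainbow m (R - {c}) k"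
    using shadow_subset[OF P0(2)] P(2) by blast
  have fbase: "finite (shadow P0 \<union> (\<Union>v\<in>Q. P v))"
    using finite_shadow P0 P(1) Q(1) by auto
  show "card (shadow (glue P0 Q P)) =
      card (shadow P0 \<union> (\<Union>v\<in>Q. P v)) + (\<Sum>v\<in>Q. card (shadow (P v)))"
  proof -
    \<comment> \<open>For \<open>k = 0\<close> the truncated \<open>k - 1\<close> is harmless, since
      the shadow is empty.\<close>
    have "shadow (P v) \<subseteq> rainbow m (R - {c}) (k - 1)" if "v \<in> Q" for v
    proof (cases k)
      case 0
      then have "P v \<subseteq> {{}}" using P(2)[OF that] by simp
      then show ?thesis by (auto simp: shadow_def)
    next
      case (Suc j)
      then show ?thesis using shadow_subset P(2)[OF that] by simp
    qed
    moreover have "finite (shadow (P v))" if "v \<in> Q" for v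
      using finite_shadow P that by blast
    ultimately show ?thesis
      using sum_ins[OF fbase base, where B = "\<lambda>v. shadow (P v)" and j = "k - 1" and f = "\<lambda>_. 1"] sh by simp
  qed
qed

text \<open>Compression in color \<open>c\<close>, stated without links: only sets with the same
  vertices of color \<open>c\<close>, possibly none, are compared.\<close>

definition color_stable :: "nat \<Rightarrow> nat set \<Rightarrow> nat \<Rightarrow> nat set set \<Rightarrow> nat \<Rightarrow> bool" where
  "color_stable m R k F c \<longleftrightarrow> (\<forall>x\<in>rainbow m R k. \<forall>y\<in>F. set_encode x < set_encode y \<longrightarrow>
     (\<forall>v. v mod m = c \<longrightarrow> (v \<in> x \<longleftrightarrow> v \<in> y)) \<longrightarrow> x \<in> F)"

text \<open>If the sets share a vertex \<open>v\<close> of color \<open>c\<close>, deleting it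
  subtracts \<open>2 ^ v\<close> from both codes, so the comparison descends to the link; otherwise
  it takes place in \<open>P0\<close>.\<close>

lemma color_stable_glue:
  assumes Q: "\<And>v. v \<in> Q \<Longrightarrow> v mod m = c"
    and P0: "colex_init (rainbow m (R - {c}) (Suc k)) P0"
    and P: "\<And>v. v \<in> Q \<Longrightarrow> colex_init (rainbow m (R - {c}) k) (P v)"
  shows "color_stable m R (Suc k) (glue P0 Q P) c"
  unfolding color_stable_def
proof (intro ballI impI)
  fix x y assume x: "x \<in> rainbow m R (Suc k)" and y: "y \<in> glue P0 Q P"
    and less: "set_encode x < set_encode y" and agree: "\<forall>v. v mod m = c \<longrightarrow> (v \<in> x \<longleftrightarrow> v \<in> y)"
  from y consider "y \<in> P0" | v T where "v \<in> Q" "T \<in> P v" "y = insert v T"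
    by (auto simp: glue_def)
  then show "x \<in> glue P0 Q P"
  proof cases
    case 1
    then have "y \<in> rainbow m (R - {c}) (Suc k)" using P0 by (auto simp: colex_init_def)
    then have "v mod m \<noteq> c" if "v \<in> x" for v
      using that agree rainbow_avoids by blast
    then have "x \<in> rainbow m (R - {c}) (Suc k)"
      using x by (auto simp: rainbow_def)
    then show ?thesis using 1 less P0 by (auto simp: colex_init_def glue_def)
  next
    case 2
    have T: "T \<in> rainbow m (R - {c}) k" using 2 P by (auto simp: colex_init_def)
    have v: "v \<in> x" "v mod m = c" using agree 2 Q by auto
    then have xv: "x - {v} \<in> rainbow m (R - {c}) k" using rainbow_remove[OF x] by auto
    have "v \<notin> T" using T v rainbow_avoids by blast
    then have "set_encode y = 2 ^ v + set_encode T" using 2 T rainbow_finite by simp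
    moreover have "set_encode x = 2 ^ v + set_encode (x - {v})"
      using set_encode_insert[of "x - {v}" v] v rainbow_finite[OF x] by (simp add: insert_absorb)
    ultimately have "x - {v} \<in> P v" using less P[OF \<open>v \<in> Q\<close>] 2 xv by (auto simp: colex_init_def)
    then have "insert v (x - {v}) \<in> glue P0 Q P" using \<open>v \<in> Q\<close> unfolding glue_def by blast
    then show ?thesis using v by (simp add: insert_absorb)
  qed
qed

text \<open>A predicate, so that \<open>compress_color\<close> can assume the theorem for fewer
  colors.\<close>

definition colex_minimizes_shadow :: "nat \<Rightarrow> nat set \<Rightarrow> nat \<Rightarrow> bool" where
  "colex_minimizes_shadow m R k \<longleftrightarrow> (\<forall>L I. finite L \<longrightarrow> L \<subseteq> rainbow m R k \<longrightarrow>
     colex_init (rainbow m R k) I \<longrightarrow> card I = card L \<longrightarrow> card (shadow I) \<le> card (shadow L))"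

text \<open>\<open>P0\<close> and all links are replaced by initial segments of the same sizes. By
  assumption the shadows of these pieces do not grow, and the faces without color \<open>c\<close>
  come from nested initial segments, so they do not increase either.\<close>

lemma compress_color:
  assumes R: "R \<subseteq> {..<m}" and c: "c \<in> R"
    and kk: "colex_minimizes_shadow m (R - {c}) k" "colex_minimizes_shadow m (R - {c}) (Suc k)"
    and F: "finite F" "F \<subseteq> rainbow m R (Suc k)" and unstable: "\<not> color_stable m R (Suc k) F c"
  obtains F' where "finite F'" "F' \<subseteq> rainbow m R (Suc k)" "card F' = card F"
    "card (shadow F') \<le> card (shadow F)" "sum set_encode F' < sum set_encode F"
proof -
  let ?X = "rainbow m (R - {c})"
  define Q where "Q = {v \<in> \<Union>F. v mod m = c}"
  define P0 where "P0 = {S \<in> F. \<forall>v\<in>S. v mod m \<noteq> c}"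
  define P where "P v = {T. insert v T \<in> F \<and> v \<notin> T}" for v
  have "finite (\<Union>F)" using F rainbow_finite by blast
  then have Q: "finite Q" "\<And>v. v \<in> Q \<Longrightarrow> v mod m = c"
    using finite_subset[of Q "\<Union>F"] by (auto simp: Q_def)
  have P0: "finite P0" "P0 \<subseteq> ?X (Suc k)"
    using F by (auto simp: P0_def rainbow_def image_subset_iff)
  have finP: "finite (P v)" for v
  proof -
    have "T \<in> (\<lambda>S. S - {v}) ` F" if "T \<in> P v" for T
      using that by (intro image_eqI[of _ _ "insert v T"]) (auto simp: P_def)
    then have "P v \<subseteq> (\<lambda>S. S - {v}) ` F" by blast
    then show ?thesis using F finite_subset by blast
  qed
  have P: "P v \<subseteq> ?X k" if "v \<in> Q" for v
  proof
    fix T assume "T \<in> P v"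
    then have "insert v T \<in> rainbow m R (Suc k)" "v \<notin> T" using F by (auto simp: P_def)
    then show "T \<in> ?X k" using rainbow_remove[of "insert v T" m R k v] Q(2)[OF that] by simp
  qed
  have F_eq: "F = glue P0 Q P"
  proof (intro equalityI subsetI)
    fix S assume S: "S \<in> F"
    show "S \<in> glue P0 Q P"
    proof (cases "S \<in> P0")
      case False
      then obtain v where v: "v \<in> S" "v mod m = c" using S by (auto simp: P0_def)
      then have "v \<in> Q" "S - {v} \<in> P v" using S by (auto simp: Q_def P_def insert_absorb)
      then have "insert v (S - {v}) \<in> glue P0 Q P" unfolding glue_def by blast
      then show ?thesis using v by (simp add: insert_absorb)
    qed (simp add: glue_def)
  qed (auto simp: glue_def P0_def P_def)
  \<comment> \<open>As a predicate it lets \<open>SOME\<close> select a compressed link for every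
    vertex at once.\<close>
  define better where "better X L I \<longleftrightarrow> colex_init X I \<and> card I = card L \<and>
    sum set_encode I \<le> sum set_encode L \<and>
    (\<not> colex_init X L \<longrightarrow> sum set_encode I < sum set_encode L)" for X L I
  define C where "C X L = (SOME I. better X L I)" for X L
  have C: "better X L (C X L)" if L: "finite L" "L \<subseteq> X" for X L
  proof -
    obtain I where "better X L I"
      using colex_compress[OF L] unfolding better_def by metis
    then show ?thesis unfolding C_def by (rule someI)
  qed
  define P0' where "P0' = C (?X (Suc k)) P0"
  define P' where "P' v = C (?X k) (P v)" for v
  have P0': "colex_init (?X (Suc k)) P0'" "card P0' = card P0"
      "sum set_encode P0' \<le> sum set_encode P0"
      "\<not> colex_init (?X (Suc k)) P0 \<Longrightarrow> sum set_encode P0' < sum set_encode P0"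
    unfolding P0'_def using C[OF P0] unfolding better_def by blast+
  have P': "colex_init (?X k) (P' v)" "card (P' v) = card (P v)"
      "sum set_encode (P' v) \<le> sum set_encode (P v)"
      "\<not> colex_init (?X k) (P v) \<Longrightarrow> sum set_encode (P' v) < sum set_encode (P v)"
      if "v \<in> Q" for v
    unfolding P'_def using C[OF finP P[OF that]] unfolding better_def by blast+
  have P0'_sub: "finite P0'" "P0' \<subseteq> ?X (Suc k)" using P0'(1) by (auto simp: colex_init_def)
  have P'_sub: "finite (P' v)" "P' v \<subseteq> ?X k" if "v \<in> Q" for v
    using P'(1)[OF that] by (auto simp: colex_init_def)
  have balls: "\<forall>v\<in>Q. v mod m = c" "\<forall>v\<in>Q. finite (P v)" "\<forall>v\<in>Q. P v \<subseteq> ?X k"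
      "\<forall>v\<in>Q. finite (P' v)" "\<forall>v\<in>Q. P' v \<subseteq> ?X k"
    using Q finP P P'_sub by auto
  note G = glue_props[OF Q(1) balls(1) c P0 balls(2,3), folded F_eq]
  note G' = glue_props[OF Q(1) balls(1) c P0'_sub balls(4,5)]
  define F' where "F' = glue P0' Q P'"
  show thesis
  proof
    show "finite F'" "F' \<subseteq> rainbow m R (Suc k)" using G'(1,2) by (auto simp: F'_def)
    show "card F' = card F" unfolding F'_def using G(3) G'(3) P0'(2) P'(2) by simp
    have sub: "R - {c} \<subseteq> {..<m}" using R by blast
    let ?b = "card (shadow P0 \<union> (\<Union>v\<in>Q. P v))"
    have fb: "finite (shadow P0 \<union> (\<Union>v\<in>Q. P v))"
      using finite_shadow[OF P0] finP Q by auto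
    have cP0: "card (shadow P0') \<le> card (shadow P0)"
      using kk(2) P0 P0'(1,2) unfolding colex_minimizes_shadow_def by blast
    have cP: "card (shadow (P' v)) \<le> card (shadow (P v))" if "v \<in> Q" for v
      using kk(1) finP[of v] P[OF that] P'(1,2)[OF that] unfolding colex_minimizes_shadow_def by blast
    \<comment> \<open>All these families are initial segments, so their union is the largest of them.\<close>
    have "card (\<Union>I\<in>insert (shadow P0') (P' ` Q). I) \<le> ?b"
    proof (rule card_UN_colex_init_le[where X = "?X k"])
      show "finite (insert (shadow P0') (P' ` Q))" using Q by simp
      show "colex_init (?X k) I" if "I \<in> insert (shadow P0') (P' ` Q)" for I
        using that colex_init_shadow[OF sub P0'(1)] P'(1) by auto
      show "card I \<le> ?b" if "I \<in> insert (shadow P0') (P' ` Q)" for I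
      proof -
        have "card (shadow P0) \<le> ?b" "\<And>v. v \<in> Q \<Longrightarrow> card (P v) \<le> ?b"
          using fb by (auto intro!: card_mono)
        then show ?thesis using that cP0 P'(2) by fastforce
      qed
    qed (rule rainbow_finite)
    then have "card (shadow P0' \<union> (\<Union>v\<in>Q. P' v)) \<le> ?b" by simp
    then show "card (shadow F') \<le> card (shadow F)"
      unfolding F'_def using G(5) G'(5) cP by (simp add: add_mono sum_mono)
    \<comment> \<open>If all pieces were initial segments already, \<open>color_stable_glue\<close>
      would make \<open>F\<close> stable.\<close>
    have "\<not> colex_init (?X (Suc k)) P0 \<or> (\<exists>v\<in>Q. \<not> colex_init (?X k) (P v))"
      using unstable color_stable_glue[OF Q(2)] F_eq by metis
    then show "sum set_encode F' < sum set_encode F"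
    proof
      assume "\<not> colex_init (?X (Suc k)) P0"
      then have "sum set_encode P0' < sum set_encode P0" by (rule P0'(4))
      moreover have "(\<Sum>v\<in>Q. 2 ^ v * card (P' v) + sum set_encode (P' v))
          \<le> (\<Sum>v\<in>Q. 2 ^ v * card (P v) + sum set_encode (P v))"
        using P'(2,3) by (intro sum_mono) simp
      ultimately show ?thesis unfolding F'_def using G(4) G'(4) by simp
    next
      assume "\<exists>v\<in>Q. \<not> colex_init (?X k) (P v)"
      then have "(\<Sum>v\<in>Q. 2 ^ v * card (P' v) + sum set_encode (P' v))
          < (\<Sum>v\<in>Q. 2 ^ v * card (P v) + sum set_encode (P v))"
        using P'(2,3,4) Q(1) by (intro sum_strict_mono_ex1) auto
      then show ?thesis unfolding F'_def using G(4) G'(4) P0'(3) by simp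
    qed
  qed
qed

subsection \<open>Shadows of rainbow families\<close>

text \<open>Stability in every color is used as one principle: a rainbow set that precedes a member
  and shares a vertex with it is a member. This makes \<open>F\<close> rich enough that trading
  members for earlier sets does not enlarge the shadow on balance.\<close>

lemma stable_improve:
  assumes R: "R \<subseteq> {..<m}" and "k \<ge> 1"
    and F: "finite F" "F \<subseteq> rainbow m R (Suc k)"
    and stable: "\<And>c. c \<in> R \<Longrightarrow> color_stable m R (Suc k) F c"
    and not_init: "\<not> colex_init (rainbow m R (Suc k)) F"
  obtains F' where "finite F'" "F' \<subseteq> rainbow m R (Suc k)" "card F' = card F"
    "card (shadow F') \<le> card (shadow F)" "sum set_encode F' < sum set_encode F"
proof -
  let ?X = "rainbow m R (Suc k)" and ?col = "\<lambda>v::nat. v mod m"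
  \<comment> \<open>Applies also when neither set has a vertex of color \<open>c\<close>.\<close>
  have agree: "x \<in> F" if "x \<in> ?X" "y \<in> F" "set_encode x \<le> set_encode y" "c \<in> R"
    "\<And>v. v mod m = c \<Longrightarrow> v \<in> x \<longleftrightarrow> v \<in> y" for x y c
  proof (cases "set_encode x = set_encode y")
    case True
    then have "x = y" using set_encode_eq[of x y] that(1,2) F rainbow_finite by blast
    then show ?thesis using that by simp
  next
    case False
    then show ?thesis using stable[OF that(4)] that unfolding color_stable_def by (meson le_neq_implies_less)
  qed
  have share: "x \<in> F" if "x \<in> ?X" "y \<in> F" "set_encode x \<le> set_encode y" "v \<in> x" "v \<in> y" for x y v
  proof (rule agree[OF that(1-3)])
    show "v mod m \<in> R" using that rainbow_color by blast
    have "y \<in> ?X" using that F by blast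
    then show "w \<in> x \<longleftrightarrow> w \<in> y" if "w mod m = v mod m" for w
      using rainbow_unique[OF \<open>x \<in> ?X\<close>, of w v] rainbow_unique[OF \<open>y \<in> ?X\<close>, of w v] that
        \<open>v \<in> x\<close> \<open>v \<in> y\<close> by blast
  qed

  obtain x1 y1 where xy1: "x1 \<in> F" "y1 \<in> ?X - F" "set_encode y1 < set_encode x1"
    using not_init F unfolding colex_init_def by blast
  obtain u where u: "u \<in> ?X - F" and u_min: "\<And>y. y \<in> ?X - F \<Longrightarrow> set_encode u \<le> set_encode y"
    using ex_has_least_nat[of "\<lambda>y. y \<in> ?X - F" y1 set_encode] xy1(2) by blast
  have "Max (set_encode ` F) \<in> set_encode ` F" using F xy1 by (intro Max_in) auto
  then obtain w where w: "w \<in> F" "set_encode w = Max (set_encode ` F)" by auto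
  then have w_max: "set_encode y \<le> set_encode w" if "y \<in> F" for y
    using that F(1) by simp
  have less: "set_encode u < set_encode w"
    using u_min[OF xy1(2)] xy1(3) w_max[OF xy1(1)] by linarith
  have uX: "u \<in> ?X" and wX: "w \<in> ?X" using u w F by auto
  have fin: "finite u" "finite w" using uX wX by (auto dest: rainbow_finite)

  define M where "M = Max w"
  define c where "c = M mod m"
  have "w \<noteq> {}" using rainbow_card[OF wX] by auto
  then have M: "M \<in> w" unfolding M_def using fin by simp
  have le_M: "v \<le> M" if "v \<in> w" for v unfolding M_def using fin that by simp
  have cR: "c \<in> R" unfolding c_def using rainbow_color wX M by blast
  \<comment> \<open>With \<open>M\<close> in common, \<open>u\<close> would be a member; a vertex of
    \<open>u\<close> above \<open>M\<close> would put \<open>u\<close> after \<open>w\<close>. So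
    \<open>u\<close> lies below \<open>M\<close>.\<close>
  have "M \<notin> u" using share[OF uX w(1) _ _ M] less u by auto
  have u_less: "v < M" if "v \<in> u" for v
  proof (rule ccontr)
    assume "\<not> v < M"
    then have "v > M" using that \<open>M \<notin> u\<close> by (metis linorder_neqE_nat)
    then have "set_encode w < set_encode u"
      using that le_M by (intro set_encode_lessI[OF fin(2,1), of v]) force+
    then show False using less by simp
  qed

  define g where "g = w - {M}"
  have g: "g \<in> rainbow m (R - {c}) k" unfolding g_def c_def using rainbow_remove[OF wX M] .
  have w_eq: "w = insert M g" "M \<notin> g" using M by (auto simp: g_def)
  have g_less: "v < M" if "v \<in> g" for v
    using that le_M[of v] by (auto simp: g_def le_less)
  \<comment> \<open>The colors of \<open>g\<close>, read as vertices, form the earliest set with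
    these colors; hence \<open>insert M B\<close> is a member along with \<open>w\<close>.\<close>
  define B where "B = ?col ` g"
  have cB: "c \<notin> B" using rainbow_color[OF g] by (auto simp: B_def)
  have "B \<subseteq> R" using rainbow_color[OF g] by (auto simp: B_def)
  have col_B: "b mod m = b" if "b \<in> B" for b
  proof -
    have "b < m" using that R \<open>B \<subseteq> R\<close> by blast
    then show ?thesis by simp
  qed
  have B_less: "b < M" if b: "b \<in> B" for b
  proof -
    obtain v where "v \<in> g" "b = v mod m" using b by (auto simp: B_def)
    then show ?thesis using g_less[of v] mod_less_eq_dividend[of v m] by linarith
  qed
  have "finite B" and cardB: "card B = k"
    using rainbow_finite[OF g] rainbow_card_colors[OF g] by (auto simp: B_def)
  have B: "B \<in> rainbow m R k"
    using \<open>finite B\<close> cardB \<open>B \<subseteq> R\<close> col_B by (auto simp: rainbow_def inj_on_def)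
  define y where "y = insert M B"
  have "y \<in> F"
  proof (rule share[OF _ w(1) _ _ M])
    show "y \<in> ?X" unfolding y_def using cR cB col_B by (intro rainbow_insert[OF B]) (auto simp: c_def)
    have "set_encode B \<le> set_encode g"
      unfolding B_def using g by (intro set_encode_image_le) (auto simp: rainbow_def)
    moreover have "M \<notin> B" using B_less by blast
    ultimately show "set_encode y \<le> set_encode w"
      unfolding y_def w_eq(1) using w_eq(2) rainbow_finite[OF g] \<open>finite B\<close> by simp
    show "M \<in> y" by (simp add: y_def)
  qed
  \<comment> \<open>A set below \<open>M\<close> always precedes \<open>y\<close>, so one common
    vertex with \<open>B\<close> suffices for membership.\<close>
  have below_y: "x \<in> F" if "x \<in> ?X" "\<And>v. v \<in> x \<Longrightarrow> v < M" "b \<in> x" "b \<in> B" for x b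
  proof (rule share[OF that(1) \<open>y \<in> F\<close> _ that(3)])
    show "set_encode x \<le> set_encode y"
      using set_encode_less_power[of x M] power_le_set_encode[of y M] that(2) \<open>finite B\<close>
      by (fastforce simp: y_def)
    show "b \<in> y" using that by (simp add: y_def)
  qed

  show thesis
  proof (cases "\<forall>e\<in>u. u - {e} \<in> shadow F")
    case True
    let ?F = "insert u (F - {w})"
    have "shadow ?F \<subseteq> shadow F" using True by (auto simp: shadow_def)
    then have "card (shadow ?F) \<le> card (shadow F)" by (intro card_mono finite_shadow[OF F])
    moreover have "card ?F = card F"
      using w u F by (metis DiffD1 DiffD2 card_Suc_Diff1 card_insert_disjoint finite_Diff)
    moreover have "sum set_encode ?F < sum set_encode F"
      using sum.remove[OF F(1) w(1), of set_encode] u F(1) less by simp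
    ultimately show thesis using F uX by (intro that[of ?F]) auto
  next
    case False
    then obtain e where e: "e \<in> u" "u - {e} \<notin> shadow F" by blast
    define S where "S = u - {e}"
    have S: "S \<in> rainbow m R k" unfolding S_def using rainbow_remove'[OF uX e(1)] .
    have S_less: "v < M" if "v \<in> S" for v using that u_less by (auto simp: S_def)
    have S_ext: "insert v S \<notin> F" if "v \<notin> S" for v
      using that e(2) shadowI unfolding S_def by blast
    \<comment> \<open>A color of \<open>B\<close> missing from \<open>S\<close> would, as a vertex,
      extend \<open>S\<close> to a member by \<open>below_y\<close>, but \<open>S\<close> is not in
      the shadow of \<open>F\<close>.\<close>
    have "B \<subseteq> ?col ` S"
    proof (rule ccontr)
      assume "\<not> B \<subseteq> ?col ` S"
      then obtain b where b: "b \<in> B" "b \<notin> ?col ` S" by blast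
      have "insert b S \<in> F"
      proof (rule below_y)
        show "insert b S \<in> ?X" using b \<open>B \<subseteq> R\<close> col_B by (intro rainbow_insert[OF S]) auto
      qed (use b B_less S_less in auto)
      moreover have "b \<notin> S" using b col_B by force
      ultimately show False using S_ext by blast
    qed
    then have colS: "?col ` S = B"
      using rainbow_card_colors[OF S] cardB rainbow_finite[OF S] by (metis card_subset_eq finite_imageI)
    have S_c: "v \<notin> S" if "v mod m = c" for v using colS cB that by blast
    have S_cX: "insert v S \<in> ?X" if "v mod m = c" for v
      using that colS cB cR by (intro rainbow_insert[OF S]) auto
    \<comment> \<open>For a further color \<open>c'\<close>, neither \<open>insert c S\<close> nor
      \<open>y\<close> has a vertex of color \<open>c'\<close>, so \<open>agree\<close> would make
      \<open>insert c S\<close> a member. Here \<open>c\<close> serves as the smallest vertex of its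
      own color.\<close>
    have RB: "R = insert c B"
    proof (rule ccontr)
      assume "R \<noteq> insert c B"
      then obtain c' where c': "c' \<in> R" "c' \<notin> B" "c' \<noteq> c" using cR \<open>B \<subseteq> R\<close> by blast
      have cm: "c mod m = c" by (simp add: c_def)
      have "insert c S \<in> F"
      proof (rule agree[OF S_cX[OF cm] \<open>y \<in> F\<close> _ c'(1)])
        have "c \<le> M" by (simp add: c_def)
        show "set_encode (insert c S) \<le> set_encode y"
        proof (cases "c = M")
          case True
          then have "v mod m = v" if "v \<in> S" for v
            using S_less[OF that] R cR by (metis lessThan_iff mod_less order_less_trans subsetD)
          then have "S = B" using colS by simp
          then show ?thesis using True by (simp add: y_def)
        next
          case False
          then have "set_encode (insert c S) < 2 ^ M"
            using \<open>c \<le> M\<close> S_less by (intro set_encode_less_power) auto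
          moreover have "2 ^ M \<le> set_encode y"
            using \<open>finite B\<close> by (intro power_le_set_encode) (auto simp: y_def)
          ultimately show ?thesis by linarith
        qed
        show "v \<in> insert c S \<longleftrightarrow> v \<in> y" if "v mod m = c'" for v
          using that c' colS cm unfolding y_def c_def by auto
      qed
      then show False using S_ext S_c[OF cm] by blast
    qed

    text \<open>Let \<open>a\<close> be the least vertex of \<open>w\<close> and \<open>T\<close> the rest of \<open>w - {M}\<close>. All members of
      \<open>F\<close> that contain \<open>insert M T\<close> arise from \<open>w\<close> by lowering \<open>a\<close> within its color; trading them
      for extensions of \<open>S\<close> by vertices of color \<open>c\<close> loses the face \<open>insert M T\<close> and gains only
      the face \<open>S\<close>.\<close>
    define a where "a = Min g"
    define T where "T = g - {a}"
    define q where "q = M div m"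
    \<comment> \<open>\<open>j\<close> counts the vertices of the color of \<open>a\<close> up to
      and including \<open>a\<close>, hence the successor; \<open>q\<close> counts the vertices of
      color \<open>c\<close> below \<open>M\<close>.\<close>
    define j where "j = Suc (a div m)"
    have "g \<noteq> {}" using rainbow_card[OF g] \<open>k \<ge> 1\<close> by auto
    then have a: "a \<in> g" unfolding a_def using rainbow_finite[OF g] by simp
    have a_le: "a \<le> v" if "v \<in> g" for v unfolding a_def using rainbow_finite[OF g] that by simp
    have M_eq: "M = c + q * m" by (simp add: c_def q_def)
    have "m > 0" using cR R by auto
    \<comment> \<open>There are enough vertices of color \<open>c\<close> below \<open>M\<close>.
      Otherwise all of \<open>g\<close> lies in the block of \<open>m\<close> vertices from
      \<open>q * m\<close> on; raising \<open>S\<close> into that block gives \<open>g\<close>, so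
      \<open>insert M S\<close> does not come after \<open>w\<close> and would be a member.\<close>
    have "j \<le> q"
    proof (rule ccontr)
      assume "\<not> j \<le> q"
      then have "q \<le> a div m" by (simp add: j_def)
      then have "q * m \<le> a" using \<open>m > 0\<close> by (simp add: less_eq_div_iff_mult_less_eq)
      have lvl: "v = q * m + v mod m" if "v \<in> g" for v
      proof -
        have "q \<le> v div m"
          using \<open>q \<le> a div m\<close> a_le[OF that] div_le_mono order_trans by blast
        moreover have "v div m \<le> q"
          unfolding q_def using g_less[OF that] by (simp add: div_le_mono)
        ultimately show ?thesis by (metis div_mult_mod_eq le_antisym)
      qed
      let ?f = "\<lambda>s. q * m + s mod m"
      have "?f ` S = (\<lambda>b. q * m + b) ` B" using colS by (simp add: image_image flip: colS)
      also have "\<dots> = g" unfolding B_def using lvl by (auto simp: image_image image_iff)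
      finally have "?f ` S = g" .
      moreover have "set_encode S \<le> set_encode (?f ` S)"
      proof (rule set_encode_image_ge)
        show "inj_on ?f S" using S by (auto simp: rainbow_def inj_on_def)
        show "s \<le> ?f s" if "s \<in> S" for s
        proof -
          have "s div m \<le> q" unfolding q_def using S_less[OF that] by (simp add: div_le_mono)
          then have "s div m * m \<le> q * m" by simp
          then show ?thesis using div_mult_mod_eq[of s m] by linarith
        qed
      qed (rule rainbow_finite[OF S])
      ultimately have "set_encode S \<le> set_encode g" by simp
      moreover have "M \<notin> S" using S_less by blast
      ultimately have "set_encode (insert M S) \<le> set_encode w"
        using w_eq rainbow_finite[OF S] rainbow_finite[OF g] by simp
      then have "insert M S \<in> F"
        using share[OF S_cX w(1) _ _ M] by (simp add: c_def)
      then show False using S_ext \<open>M \<notin> S\<close> by blast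
    qed

    have T: "T \<in> rainbow m (R - {c} - {a mod m}) (k - 1)"
      unfolding T_def using rainbow_remove[of g m "R - {c}" "k - 1" a] g a \<open>k \<ge> 1\<close> by simp
    have colT: "?col ` T = B - {a mod m}"
      unfolding T_def B_def using rainbow_unique[OF g _ a] by auto
    have aM: "a mod m \<noteq> c" "a mod m \<in> R" using rainbow_color[OF g a] by auto
    have av: "v \<notin> T" "v \<noteq> M" if "v mod m = a mod m" for v
      using that rainbow_color[OF T, of v] aM by (auto simp: c_def)
    have "M \<notin> T" using w_eq by (auto simp: T_def)
    define rem where "rem i = insert (a mod m + i * m) (insert M T)" for i
    define add where "add i = insert (c + i * m) S" for i
    have low: "a mod m + i * m \<le> a" if "i < j" for i
    proof -
      have "i * m \<le> a div m * m" using that by (simp add: j_def)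
      then show ?thesis using div_mult_mod_eq[of a m] by linarith
    qed
    have remF: "rem i \<in> F" if "i < j" for i
    proof (rule share[OF _ w(1) _ _ M])
      let ?a = "a mod m + i * m"
      have "?a mod m = a mod m" by simp
      note av' = av[OF this]
      have "insert ?a T \<in> rainbow m (R - {c}) k"
      proof -
        have "T \<in> rainbow m (R - {c}) (k - 1)"
          using T rainbow_mono[of "R - {c} - {a mod m}" "R - {c}"] by blast
        moreover have "a mod m \<notin> ?col ` T" using colT by blast
        ultimately show ?thesis
          using rainbow_insert[of T m "R - {c}" "k - 1" ?a] aM \<open>k \<ge> 1\<close> by simp
      qed
      note aT = this
      have "insert ?a T \<in> rainbow m R k" using aT rainbow_mono[of "R - {c}" R] by blast
      moreover have "M mod m \<notin> ?col ` insert ?a T"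
        using rainbow_color[OF aT] unfolding c_def by fastforce
      ultimately have "insert M (insert ?a T) \<in> ?X"
        using cR unfolding c_def by (intro rainbow_insert)
      then show "rem i \<in> ?X" by (simp add: rem_def insert_commute)
      have "finite T" using T by (rule rainbow_finite)
      have "w = insert a (insert M T)" using w_eq a by (auto simp: T_def)
      then have "set_encode w = 2 ^ a + set_encode (insert M T)"
        using av[of a] \<open>finite T\<close> by simp
      moreover have "set_encode (rem i) = 2 ^ ?a + set_encode (insert M T)"
        using av' \<open>finite T\<close> by (simp add: rem_def)
      ultimately show "set_encode (rem i) \<le> set_encode w" using low[OF that] by simp
      show "M \<in> rem i" by (simp add: rem_def)
    qed
    have inj_rem: "inj_on rem {..<j}"
    proof (rule inj_onI)
      fix i i' assume eq: "rem i = rem i'"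
      have "a mod m + i * m \<in> rem i'" unfolding eq[symmetric] by (simp add: rem_def)
      moreover have "(a mod m + i * m) mod m = a mod m" by simp
      from av[OF this] have "a mod m + i * m \<notin> insert M T" by simp
      ultimately have "a mod m + i * m = a mod m + i' * m" unfolding rem_def by blast
      then show "i = i'" using \<open>m > 0\<close> by simp
    qed
    have inj_add: "inj_on add {..<j}"
    proof (rule inj_onI)
      fix i i' assume eq: "add i = add i'"
      have "c + i * m \<in> add i'" unfolding eq[symmetric] by (simp add: add_def)
      moreover have "c + i * m \<notin> S" by (rule S_c) (simp add: c_def)
      ultimately have "c + i * m = c + i' * m" unfolding add_def by blast
      then show "i = i'" using \<open>m > 0\<close> by simp
    qed
    have cim: "(c + i * m) mod m = c" for i by (simp add: c_def)
    have add_less: "v < M" if "i < j" "v \<in> add i" for i v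
    proof -
      have "i * m < q * m" using that(1) \<open>j \<le> q\<close> \<open>m > 0\<close> by simp
      then show ?thesis using that(2) S_less M_eq by (auto simp: add_def)
    qed
    have addX: "add i \<in> ?X" "add i \<notin> F" for i
      using S_cX[OF cim] S_ext[OF S_c[OF cim]] by (auto simp: add_def)
    define Add where "Add = add ` {..<j}"
    define Rem where "Rem = rem ` {..<j}"
    define F' where "F' = (F - Rem) \<union> Add"
    have AR: "Rem \<subseteq> F" "Add \<inter> F = {}" "finite Rem" "finite Add" "Add \<subseteq> ?X" "card Rem = j" "card Add = j"
      unfolding Rem_def Add_def using remF addX by (auto simp: card_image inj_rem inj_add)
    have "j > 0" by (simp add: j_def)
    show thesis
    proof
      show "finite F'" "F' \<subseteq> ?X" using F AR by (auto simp: F'_def)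
      have "(F - Rem) \<inter> Add = {}" using AR by blast
      then have "card F' = card (F - Rem) + j"
        unfolding F'_def using F(1) AR by (simp add: card_Un_disjoint)
      also have "\<dots> = card F"
        using AR F(1) card_mono[OF F(1) AR(1)] by (simp add: card_Diff_subset)
      finally show "card F' = card F" .
      have "sum set_encode F' = sum set_encode (F - Rem) + sum set_encode Add"
        unfolding F'_def using F(1) AR \<open>(F - Rem) \<inter> Add = {}\<close> by (intro sum.union_disjoint) auto
      moreover have "sum set_encode F = sum set_encode (F - Rem) + sum set_encode Rem"
        using sum.subset_diff[OF AR(1) F(1)] .
      moreover have "sum set_encode Add < sum set_encode Rem"
        unfolding Add_def Rem_def sum.reindex[OF inj_add] sum.reindex[OF inj_rem]
      proof (rule sum_strict_mono)
        fix i assume "i \<in> {..<j}"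
        then have "set_encode (add i) < 2 ^ M" using add_less by (intro set_encode_less_power) auto
        also have "\<dots> \<le> set_encode (rem i)"
          using rainbow_finite[OF T] by (intro power_le_set_encode) (auto simp: rem_def)
        finally show "(set_encode \<circ> add) i < (set_encode \<circ> rem) i" by simp
      qed (use \<open>j > 0\<close> in auto)
      ultimately show "sum set_encode F' < sum set_encode F" by simp
      \<comment> \<open>A member of \<open>F\<close> extending \<open>insert M T\<close> must do so
        in the color of \<open>a\<close>, because \<open>R = insert c B\<close>, and maximality of
        \<open>w\<close> bounds the new vertex by \<open>a\<close>; so all such members were
        removed. The added sets lie below \<open>M\<close>.\<close>
      have lost: "insert M T \<notin> shadow F'"
      proof
        assume "insert M T \<in> shadow F'"
        then obtain f where f: "insert f (insert M T) \<in> F'" "f \<notin> insert M T" by (rule shadowE)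
        show False
        proof (cases "insert f (insert M T) \<in> Add")
          case True
          then obtain i where "i < j" "M \<in> add i" unfolding Add_def by blast
          then show False using add_less by blast
        next
          case False
          then have fF: "insert f (insert M T) \<in> F" "insert f (insert M T) \<notin> Rem"
            using f by (auto simp: F'_def)
          then have fX: "insert f (insert M T) \<in> ?X" using F by blast
          have "f mod m \<noteq> v mod m" if "v \<in> insert M T" for v
            using rainbow_unique[OF fX, of f v] that f(2) by blast
          moreover have "f mod m \<in> R" using rainbow_color[OF fX] by blast
          ultimately have "f mod m \<notin> ?col ` T" "f mod m \<noteq> c" "f mod m \<in> insert c B"
            using RB by (auto simp: c_def)
          then have fa: "f mod m = a mod m" using colT by blast
          have "2 ^ f + set_encode (insert M T) = set_encode (insert f (insert M T))"
            using f(2) rainbow_finite[OF T] by simp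
          also have "\<dots> \<le> set_encode w" using w_max fF by blast
          also have "w = insert a (insert M T)" using w_eq a by (auto simp: T_def)
          also have "set_encode \<dots> = 2 ^ a + set_encode (insert M T)"
            using av[of a] rainbow_finite[OF T] by simp
          finally have "f \<le> a" by simp
          then have "f div m < j" by (simp add: j_def div_le_mono less_Suc_eq_le)
          moreover have "a mod m + f div m * m = f" using fa div_mult_mod_eq[of f m] by linarith
          then have "insert f (insert M T) = rem (f div m)" by (simp add: rem_def)
          ultimately have "insert f (insert M T) \<in> Rem" by (simp add: Rem_def)
          then show False using fF by blast
        qed
      qed
      \<comment> \<open>A face of \<open>add i\<close> other than \<open>S\<close> lacks one color
        of \<open>B\<close>; the smallest vertex of that color extends it to a member of
        \<open>F\<close> by \<open>below_y\<close>.\<close>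
      have gain: "shadow F' \<subseteq> insert S (shadow F)"
      proof
        fix Z assume "Z \<in> shadow F'"
        then obtain f where f: "insert f Z \<in> F'" "f \<notin> Z" by (rule shadowE)
        show "Z \<in> insert S (shadow F)"
        proof (cases "insert f Z \<in> Add")
          case False
          then show ?thesis using f shadowI by (auto simp: F'_def)
        next
          case True
          then obtain i where i: "i < j" "insert f Z = add i" by (auto simp: Add_def)
          let ?v = "c + i * m"
          have Z: "Z = add i - {f}" using i f by auto
          show ?thesis
          proof (cases "f = ?v")
            case True
            then show ?thesis using Z S_c[OF cim] by (auto simp: add_def)
          next
            case False
            then have fS: "f \<in> S" using i by (auto simp: add_def)
            let ?b = "f mod m"
            have "add i \<in> rainbow m R (Suc k)" using addX by blast
            from rainbow_remove[OF this, of f] have Zr: "Z \<in> rainbow m (R - {?b}) k"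
              using Z i by auto
            have "insert ?b Z \<in> F"
            proof (rule below_y)
              have "Z \<in> rainbow m R k" using Zr rainbow_mono[of "R - {?b}" R] by blast
              moreover have "?b mod m \<notin> ?col ` Z" using rainbow_color[OF Zr] by fastforce
              ultimately show "insert ?b Z \<in> ?X"
                using rainbow_color[OF S fS] by (intro rainbow_insert) auto
              show "?b \<in> B" using colS fS by blast
              then show "v < M" if "v \<in> insert ?b Z" for v
                using that Z add_less[OF i(1)] B_less by blast
            qed simp
            moreover have "?b \<notin> Z" using rainbow_color[OF Zr, of ?b] by auto
            ultimately show ?thesis using shadowI by blast
          qed
        qed
      qed
      have "w = insert a (insert M T)" using w_eq a by (auto simp: T_def)
      then have lostF: "insert M T \<in> shadow F"
        using w(1) av[of a] by (intro shadowI[of a]) auto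
      have fs: "finite (shadow F)" using finite_shadow[OF F] .
      have "card (shadow F') \<le> card (insert S (shadow F - {insert M T}))"
        using gain lost fs by (intro card_mono) auto
      also have "\<dots> \<le> Suc (card (shadow F - {insert M T}))"
        by (rule card_insert_le_m1) simp_all
      also have "\<dots> = card (shadow F)"
        using lostF fs by (metis card_Suc_Diff1)
      finally show "card (shadow F') \<le> card (shadow F)" .
    qed
  qed
qed

text \<open>Induction on the number of colors, for all sizes at once because compression needs two
  of them. Among the families of the size of \<open>L\<close> whose shadow is no larger, one of
  least code sum admits neither improvement, so it is an initial segment and equals
  \<open>I\<close>.\<close>

theorem colored_kruskal_katona:
  assumes R: "R \<subseteq> {..<m}"
  shows "colex_minimizes_shadow m R k"
  using R
proof (induction "card R" arbitrary: R k rule: less_induct)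
  case (less R k)
  have "finite R" using less.prems finite_subset by blast
  have IH: "colex_minimizes_shadow m (R - {c}) j" if "c \<in> R" for c j
    using that less.prems \<open>finite R\<close> by (intro less.hyps card_Diff1_less) auto
  show ?case
    unfolding colex_minimizes_shadow_def
  proof (intro allI impI)
    fix L I assume L: "finite L" "L \<subseteq> rainbow m R k"
      and I: "colex_init (rainbow m R k) I" and card_I: "card I = card L"
    have I_sub: "finite I" "I \<subseteq> rainbow m R k" using I by (auto simp: colex_init_def)
    consider "k = 0" | "k = 1" | j where "k = Suc j" "j \<ge> 1"
      by (cases k) (auto simp: Suc_le_eq)
    then show "card (shadow I) \<le> card (shadow L)"
    proof cases
      case 1
      then have "shadow I = {}" using I_sub by (auto simp: shadow_def)
      then show ?thesis by simp
    next
      \<comment> \<open>\<open>stable_improve\<close> does not cover singletons, but the shadow of a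
        nonempty family of them is always \<open>{{}}\<close>.\<close>
      case 2
      show ?thesis
      proof (cases "I = {}")
        case False
        then have "L \<noteq> {}" using card_I I_sub L by auto
        then obtain S where S: "S \<in> L" by blast
        then have "card S = 1" using L 2 rainbow_card by blast
        then have "S \<noteq> {}" by auto
        then have "shadow L \<noteq> {}" using S by (auto simp: shadow_def)
        then have "card (shadow L) \<ge> 1" using finite_shadow[OF L] by (simp add: Suc_le_eq card_gt_0_iff)
        moreover have "shadow I \<subseteq> {{}}" using shadow_subset[of I m R 0] I_sub 2 by simp
        then have "card (shadow I) \<le> 1" using card_mono[of "{{}}" "shadow I"] by simp
        ultimately show ?thesis by simp
      qed simp
    next
      case 3
      let ?P = "\<lambda>F. finite F \<and> F \<subseteq> rainbow m R k \<and> card F = card L \<and> card (shadow F) \<le> card (shadow L)"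
      have "?P L" using L by simp
      from ex_has_least_nat[of ?P, OF this, of "sum set_encode"]
      obtain F where F: "?P F" and least: "\<And>F'. ?P F' \<Longrightarrow> sum set_encode F \<le> sum set_encode F'"
        by (elim exE conjE) auto
      have no_better: False if "finite F'" "F' \<subseteq> rainbow m R k" "card F' = card F"
        "card (shadow F') \<le> card (shadow F)" "sum set_encode F' < sum set_encode F" for F'
        using least[of F'] that F by simp
      have stable: "color_stable m R (Suc j) F c" if c: "c \<in> R" for c
      proof (rule ccontr)
        assume "\<not> color_stable m R (Suc j) F c"
        from compress_color[OF less.prems c IH[OF c] IH[OF c] _ _ this] show False
          using no_better F 3 by blast
      qed
      have "colex_init (rainbow m R k) F"
      proof (rule ccontr)
        assume "\<not> colex_init (rainbow m R k) F"
        then show False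
          using stable_improve[OF less.prems 3(2) _ _ stable] no_better F 3 by blast
      qed
      then have "I = F"
        using rainbow_init_subset[OF I, of F] rainbow_init_subset[OF _ I, of F] F card_I
        by (intro equalityI) simp_all
      then show ?thesis using F by simp
    qed
  qed
qed

subsection \<open>Clique numbers\<close>

text \<open>The condition \<open>u \<noteq> v\<close> keeps \<open>v\<close> out even if
  \<open>{v}\<close> lies in \<open>E\<close>, which is an arbitrary set of sets here.\<close>

definition nbrs :: "'a set \<Rightarrow> 'a set set \<Rightarrow> 'a \<Rightarrow> 'a set" where
  "nbrs W E v = {u \<in> W. u \<noteq> v \<and> {v, u} \<in> E}"

lemma clique_count_0 [simp]: "clique_count 0 W E = 1"
proof -
  have "{K \<in> nsets W 0. clique K E} = {{}}" by (auto simp: nsets_def clique_def)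
  then show ?thesis by (simp add: clique_count_def)
qed

lemma finite_cliques: "finite W \<Longrightarrow> finite {K \<in> nsets W i. clique K E}"
  by (simp add: finite_imp_finite_nsets)

lemma clique_count_mono:
  assumes "finite W" "U \<subseteq> W"
  shows "clique_count i U E \<le> clique_count i W E"
  unfolding clique_count_def
  using assms by (intro card_mono finite_cliques) (auto simp: nsets_def)

lemma clique_count_large: "finite W \<Longrightarrow> i > card W \<Longrightarrow> clique_count i W E = 0"
  by (auto simp: clique_count_def nsets_def dest: card_mono)

text \<open>The cliques through \<open>v\<close> are those of its neighborhood with \<open>v\<close>
  added.\<close>

lemma clique_count_insert:
  assumes "finite W" "v \<notin> W"
  shows "clique_count (Suc i) (insert v W) E = clique_count (Suc i) W E + clique_count i (nbrs W E v) E"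
proof -
  let ?A = "{K \<in> nsets W (Suc i). clique K E}" and ?B = "{K \<in> nsets (nbrs W E v) i. clique K E}"
  have notin: "v \<notin> K" if "K \<in> ?B" for K using that by (auto simp: nsets_def nbrs_def)
  have "{K \<in> nsets (insert v W) (Suc i). clique K E} = ?A \<union> insert v ` ?B"
  proof (intro equalityI subsetI)
    fix K assume K: "K \<in> {K \<in> nsets (insert v W) (Suc i). clique K E}"
    show "K \<in> ?A \<union> insert v ` ?B"
    proof (cases "v \<in> K")
      case True
      then have "K - {v} \<in> ?B" using K by (auto simp: nsets_def nbrs_def clique_def)
      then have "insert v (K - {v}) \<in> insert v ` ?B" by blast
      then show ?thesis using True by (simp add: insert_absorb)
    next
      case False
      then show ?thesis using K by (auto simp: nsets_def)
    qed
  next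
    fix K assume "K \<in> ?A \<union> insert v ` ?B"
    then show "K \<in> {K \<in> nsets (insert v W) (Suc i). clique K E}"
    proof
      assume "K \<in> insert v ` ?B"
      then obtain K' where K': "K' \<in> ?B" "K = insert v K'" by blast
      then have "clique K E" by (auto simp: nsets_def nbrs_def clique_def insert_commute)
      moreover have "K \<in> nsets (insert v W) (Suc i)"
        using K' notin[OF K'(1)] by (auto simp: nsets_def nbrs_def)
      ultimately show ?thesis by simp
    qed (auto simp: nsets_def)
  qed
  moreover have "?A \<inter> insert v ` ?B = {}" using assms by (auto simp: nsets_def)
  moreover have "finite ?A" "finite ?B" using assms by (auto simp: finite_cliques nbrs_def)
  moreover have "inj_on (insert v) ?B" using notin by (intro inj_onI) (metis insert_ident)
  ultimately show ?thesis by (simp add: clique_count_def card_Un_disjoint card_image)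
qed

lemma no_clique_nbrs:
  assumes "finite W" "v \<in> W" "U \<subseteq> nbrs W E v" "clique_count (Suc i) W E = 0"
  shows "clique_count i U E = 0"
proof -
  have "nbrs (W - {v}) E v = nbrs W E v" by (auto simp: nbrs_def)
  then have "clique_count i (nbrs W E v) E = 0"
    using clique_count_insert[of "W - {v}" v i E] assms by (simp add: insert_absorb)
  moreover have "finite (nbrs W E v)" using assms by (simp add: nbrs_def)
  ultimately show ?thesis using clique_count_mono[of "nbrs W E v" U i E] assms by simp
qed

text \<open>One level in isolation: the cliques of size \<open>k\<close> are matched exactly, while
  the level below only has to leave room for the shadow. For \<open>k = 0\<close> there is no level
  below.\<close>

definition clique_realizable :: "nat \<Rightarrow> nat set \<Rightarrow> nat \<Rightarrow> 'a set \<Rightarrow> 'a set set \<Rightarrow> bool" where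
  "clique_realizable m R k W E \<longleftrightarrow> (\<exists>F. finite F \<and> F \<subseteq> rainbow m R k \<and> card F = clique_count k W E \<and>
     (\<forall>j. k = Suc j \<longrightarrow> card (shadow F) \<le> clique_count j W E))"

text \<open>By \<open>colored_kruskal_katona\<close>, passing to the initial segment of the same
  size does not enlarge the shadow; this makes separate models comparable by size.\<close>

lemma clique_realizable_init:
  assumes R: "R \<subseteq> {..<m}" and real: "clique_realizable m R k W E"
  obtains I where "colex_init (rainbow m R k) I" "card I = clique_count k W E"
    "\<And>j. k = Suc j \<Longrightarrow> card (shadow I) \<le> clique_count j W E"
proof -
  obtain F where F: "finite F" "F \<subseteq> rainbow m R k" "card F = clique_count k W E"
    "\<And>j. k = Suc j \<Longrightarrow> card (shadow F) \<le> clique_count j W E"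
    using real unfolding clique_realizable_def by blast
  obtain I where I: "colex_init (rainbow m R k) I" "card I = card F"
    using colex_compress[OF F(1,2)] .
  have "card (shadow I) \<le> card (shadow F)"
    using colored_kruskal_katona[OF R, of k] I F unfolding colex_minimizes_shadow_def by blast
  then show thesis using that[OF I(1)] I(2) F(3,4) by (metis le_trans)
qed

text \<open>Split the cliques by their last vertex outside the neighborhood of a vertex of maximal
  degree: the links of these vertices have no larger cliques than that neighborhood, so their
  models with one color less are nested inside its model.\<close>

lemma clique_realizable_insert:
  fixes E :: "'a set set"
  assumes R: "insert c R \<subseteq> {..<m}" and "c \<notin> R" and V: "finite V" "V \<noteq> {}"
    and IH: "\<And>U j. U \<subseteq> V \<Longrightarrow> clique_count (Suc (card R)) U E = 0 \<Longrightarrow> clique_realizable m R j U E"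
    and free: "clique_count (Suc (Suc (card R))) V E = 0"
  shows "clique_realizable m (insert c R) (Suc k) V E"
proof -
  let ?X = "rainbow m (insert c R)"
  have Rm: "R \<subseteq> {..<m}" using R by blast
  have IH': "clique_realizable m R j U E" if "v \<in> V" "U \<subseteq> nbrs V E v" for v U j
    using that no_clique_nbrs[OF V(1) that free] by (intro IH) (auto simp: nbrs_def)
  let ?deg = "\<lambda>v. clique_count k (nbrs V E v) E"
  have "Max (?deg ` V) \<in> ?deg ` V" using V by (intro Max_in) auto
  then obtain v0 where v0: "v0 \<in> V" "?deg v0 = Max (?deg ` V)" by auto
  have max: "?deg v \<le> ?deg v0" if "v \<in> V" for v
    using v0(2) V(1) that by simp
  define N where "N = nbrs V E v0"
  have N: "N \<subseteq> V" "finite N" "v0 \<notin> N" using V by (auto simp: N_def nbrs_def)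
  have realN: "clique_realizable m R j N E" for j unfolding N_def using IH'[OF v0(1)] by blast
  obtain J where J: "colex_init (rainbow m R k) J" "card J = clique_count k N E"
    using clique_realizable_init[OF Rm realN] by metis
  obtain A where A: "colex_init (rainbow m R (Suc k)) A" "card A = clique_count (Suc k) N E"
    "card (shadow A) \<le> clique_count k N E"
    using clique_realizable_init[OF Rm realN] by metis
  have "shadow A \<subseteq> J"
    using rainbow_init_subset[OF colex_init_shadow[OF Rm A(1)] J(1)] A(3) J(2) by simp
  have "finite J" "J \<subseteq> rainbow m R k" using J by (auto simp: colex_init_def)
  \<comment> \<open>The vertices outside \<open>N\<close> are added one at a time. Counting
    \<open>J\<close> together with the shadow leaves room for the bases of later cones, which all
    lie in \<open>J\<close>; at the start \<open>J\<close> has exactly the size of the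
    bound.\<close>
  have "\<exists>F. finite F \<and> F \<subseteq> ?X (Suc k) \<and> card F = clique_count (Suc k) (N \<union> U) E \<and>
      card (shadow F \<union> J) \<le> clique_count k (N \<union> U) E" if "finite U" "U \<subseteq> V - N" for U
    using that
  proof (induction U rule: finite_induct)
    case empty
    have "shadow A \<union> J = J" using \<open>shadow A \<subseteq> J\<close> by blast
    then show ?case
      using A J rainbow_mono[of R "insert c R" m "Suc k"] by (intro exI[of _ A]) (auto simp: colex_init_def)
  next
    case (insert v U)
    let ?W = "N \<union> U" and ?L = "nbrs (N \<union> U) E v"
    obtain F where F: "finite F" "F \<subseteq> ?X (Suc k)" "card F = clique_count (Suc k) ?W E"
      "card (shadow F \<union> J) \<le> clique_count k ?W E"
      using insert by auto
    have W: "finite ?W" "v \<notin> ?W" "v \<in> V" "?W \<subseteq> V" using insert N by auto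
    then have L: "?L \<subseteq> nbrs V E v" "finite ?L" "finite (nbrs V E v)"
      using V by (auto simp: nbrs_def)
    obtain B where B: "colex_init (rainbow m R k) B" "card B = clique_count k ?L E"
      "\<And>j. k = Suc j \<Longrightarrow> card (shadow B) \<le> clique_count j ?L E"
      using clique_realizable_init[OF Rm IH'[OF W(3) L(1)]] by metis
    \<comment> \<open>By the choice of \<open>v0\<close>, the neighborhood of \<open>v\<close> has
      no more \<open>k\<close>-cliques than \<open>N\<close>, so the model of its part in
      \<open>?W\<close> lies inside \<open>J\<close>.\<close>
    have "card B \<le> card J"
      using B(2) J(2) max[OF W(3)] clique_count_mono[OF L(3,1), of k E] by (simp add: N_def)
    then have "B \<subseteq> J" by (rule rainbow_init_subset[OF B(1) J(1)])
    have Bsub: "finite B" "B \<subseteq> rainbow m R k" using B by (auto simp: colex_init_def)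
    have "finite (\<Union>F)" using F rainbow_finite by blast
    then obtain n where n: "\<forall>a\<in>\<Union>F. a < n" using finite_nat_set_iff_bounded by blast
    \<comment> \<open>The apex is a vertex of color \<open>c\<close> beyond all vertices used so
      far.\<close>
    define x where "x = c + n * m"
    have "c < m" using R by blast
    then have x: "x mod m = c" and "x \<ge> n" by (auto simp: x_def trans_le_add2)
    have x_fresh: "x \<notin> S" if "S \<in> F" for S
      using n that \<open>x \<ge> n\<close> by (meson UnionI not_le)
    have x_B: "x \<notin> T" "x mod m \<notin> (\<lambda>v. v mod m) ` T" if "T \<in> rainbow m R j" for T j
      using rainbow_color[OF that] x \<open>c \<notin> R\<close> by auto
    let ?F = "F \<union> insert x ` B"
    have "inj_on (insert x) B" using x_B(1) Bsub by (intro inj_onI) (metis insert_ident subsetD)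
    moreover have "F \<inter> insert x ` B = {}" using x_fresh by blast
    ultimately have "card ?F = clique_count (Suc k) (insert v ?W) E"
      using F Bsub B(2) clique_count_insert[OF W(1,2)] by (simp add: card_Un_disjoint card_image)
    moreover have "insert x T \<in> ?X (Suc k)" if "T \<in> B" for T
    proof (rule rainbow_insert)
      show "T \<in> ?X k" using that Bsub rainbow_mono[of R "insert c R" m k] by blast
      show "x mod m \<in> insert c R" using x by simp
      show "x mod m \<notin> (\<lambda>v. v mod m) ` T" using x_B(2) that Bsub by blast
    qed
    then have "?F \<subseteq> ?X (Suc k)" using F by blast
    moreover have "card (shadow ?F \<union> J) \<le> clique_count k (insert v ?W) E"
    proof -
      \<comment> \<open>Deleting the apex gives a member of \<open>B\<close>, already counted in
        \<open>J\<close>; only the faces through \<open>x\<close> are new.\<close>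
      have "shadow (insert x ` B) \<subseteq> J \<union> insert x ` shadow B"
      proof
        fix Z assume "Z \<in> shadow (insert x ` B)"
        then obtain T e where T: "T \<in> B" "e \<in> insert x T" "Z = insert x T - {e}"
          by (auto simp: shadow_def)
        have "x \<notin> T" using x_B(1) T Bsub by blast
        show "Z \<in> J \<union> insert x ` shadow B"
        proof (cases "e = x")
          case True
          then show ?thesis using T \<open>x \<notin> T\<close> \<open>B \<subseteq> J\<close> by auto
        next
          case False
          then have "Z = insert x (T - {e})" "e \<in> T" using T by auto
          then show ?thesis using T by (auto simp: shadow_def)
        qed
      qed
      then have "shadow ?F \<union> J \<subseteq> (shadow F \<union> J) \<union> insert x ` shadow B"
        unfolding shadow_Un by blast
      then have "card (shadow ?F \<union> J) \<le> card ((shadow F \<union> J) \<union> insert x ` shadow B)"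
        using finite_shadow[OF F(1,2)] finite_shadow[OF Bsub] \<open>finite J\<close>
        by (intro card_mono finite_UnI finite_imageI)
      also have "\<dots> \<le> card (shadow F \<union> J) + card (insert x ` shadow B)"
        by (rule card_Un_le)
      also have "\<dots> \<le> clique_count k ?W E + card (shadow B)"
        using F(4) card_image_le[OF finite_shadow[OF Bsub], of "insert x"] by (intro add_mono)
      also have "\<dots> \<le> clique_count k (insert v ?W) E"
      proof (cases k)
        case 0
        then have "shadow B = {}" using Bsub by (auto simp: shadow_def)
        then show ?thesis using 0 by simp
      next
        case (Suc j)
        then show ?thesis using B(3)[OF Suc] clique_count_insert[OF W(1,2)] by simp
      qed
      finally show ?thesis .
    qed
    moreover have "finite ?F" using F Bsub by blast
    moreover have "N \<union> insert v U = insert v ?W" by blast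
    ultimately show ?case by metis
  qed
  from this[of "V - N"] V N obtain F where F: "finite F" "F \<subseteq> ?X (Suc k)"
    "card F = clique_count (Suc k) V E" "card (shadow F \<union> J) \<le> clique_count k V E"
    by (auto simp: Un_absorb1)
  have "card (shadow F) \<le> card (shadow F \<union> J)"
    using finite_shadow[OF F(1,2)] \<open>finite J\<close> by (intro card_mono) auto
  then have "card (shadow F) \<le> clique_count k V E" using F(4) by linarith
  then show ?thesis using F(1-3) unfolding clique_realizable_def by blast
qed

text \<open>Induction on the set of colors, with the vertex set arbitrary since the step passes to
  parts of neighborhoods.\<close>

lemma clique_realizable:
  fixes E :: "'a set set"
  assumes "R \<subseteq> {..<m}" "finite V" "clique_count (Suc (card R)) V E = 0"
  shows "clique_realizable m R k V E"
proof -
  have "finite R" using assms(1) finite_subset by blast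
  then show ?thesis using assms
  proof (induction R arbitrary: V k rule: finite_induct)
    case empty
    \<comment> \<open>Without colors the hypothesis excludes cliques on one vertex.\<close>
    have "V = {}"
    proof (rule ccontr)
      assume "V \<noteq> {}"
      then obtain v where "v \<in> V" by blast
      then have "{v} \<in> {K \<in> nsets V 1. clique K E}" by (auto simp: nsets_def clique_def)
      then show False using empty finite_cliques[of V 1 E] by (auto simp: clique_count_def)
    qed
    show ?case
    proof (cases k)
      case 0
      then show ?thesis unfolding clique_realizable_def by (intro exI[of _ "{{}}"]) simp
    next
      case (Suc j)
      then have "clique_count k V E = 0" using \<open>V = {}\<close> by (intro clique_count_large) auto
      then show ?thesis unfolding clique_realizable_def by (intro exI[of _ "{}"]) simp
    qed
  next
    case (insert c R)
    consider "k = 0" | "V = {}" "k > 0" | j where "V \<noteq> {}" "k = Suc j" by (cases k) auto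
    then show ?case
    proof cases
      case 1
      then show ?thesis unfolding clique_realizable_def by (intro exI[of _ "{{}}"]) simp
    next
      case 2
      then have "clique_count k V E = 0" by (intro clique_count_large) auto
      then show ?thesis unfolding clique_realizable_def by (intro exI[of _ "{}"]) simp
    next
      case 3
      have "clique_realizable m R i U E" if "U \<subseteq> V" "clique_count (Suc (card R)) U E = 0" for U i
      proof (rule insert.IH[OF _ _ that(2)])
        show "R \<subseteq> {..<m}" using insert.prems by blast
        show "finite U" using that insert.prems finite_subset by blast
      qed
      moreover have "clique_count (Suc (Suc (card R))) V E = 0"
        using insert.prems(3) insert.hyps by simp
      ultimately show ?thesis
        unfolding 3(2) using clique_realizable_insert[OF insert.prems(1) insert.hyps(2) insert.prems(2) 3(1)]
        by blast
    qed
  qed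
qed

section \<open>Assembling the complex from its levels\<close>

theorem theorem4:
  fixes r :: nat and V :: "'a set" and E :: "'a set set"
  assumes "r > 0"
    and "fin_simple_graph V E"
    and "clique_count (r + 1) V E = 0"
  shows "\<exists>(W :: nat set) C. abstract_complex W C \<and> complex_colorable r W C \<and>
           (\<forall>i. face_count i C = clique_count i V E)"
proof -
  let ?X = "rainbow r {..<r}"
  have V: "finite V" using assms(2) by (simp add: fin_simple_graph_def)
  have real: "clique_realizable r {..<r} i V E" for i
    using V assms(3) by (intro clique_realizable) auto
  have "\<exists>I. colex_init (?X i) I \<and> card I = clique_count i V E \<and>
      (\<forall>j. i = Suc j \<longrightarrow> card (shadow I) \<le> clique_count j V E)" for i
    using clique_realizable_init[OF order_refl real] by metis
  then obtain I where init: "\<And>i. colex_init (?X i) (I i)"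
    and card_I: "\<And>i. card (I i) = clique_count i V E"
    and card_shadow: "\<And>j. card (shadow (I (Suc j))) \<le> clique_count j V E"
    by metis
  have I: "finite (I i)" "I i \<subseteq> ?X i" for i using init[of i] by (auto simp: colex_init_def)
  \<comment> \<open>Both sides are initial segments of the same level, so comparing sizes yields
    inclusion; this closes the union of the levels under subsets.\<close>
  have shadow_I: "shadow (I (Suc j)) \<subseteq> I j" for j
    using card_shadow card_I
    by (intro rainbow_init_subset[OF colex_init_shadow[OF order_refl init] init]) metis
  define C where "C = (\<Union>i. I i)"
  define W where "W = \<Union>C"
  have I_level: "S \<in> I (card S)" if S: "S \<in> C" for S
  proof -
    obtain i where i: "S \<in> I i" using S by (auto simp: C_def)
    then have "card S = i" using I(2)[of i] rainbow_card by blast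
    then show ?thesis using i by simp
  qed
  have finC: "finite C"
  proof -
    \<comment> \<open>Only finitely many levels are nonempty, because a clique has at most
      \<open>card V\<close> vertices.\<close>
    have "I i = {}" if "i > card V" for i
      using clique_count_large[OF V that] card_I[of i] I(1) by simp
    then have "i \<le> card V" if "S \<in> I i" for S i
      using that by (metis empty_iff not_le)
    then have "C = (\<Union>i\<le>card V. I i)" unfolding C_def by blast
    then show ?thesis using I(1) by simp
  qed
  have finS: "finite S" if "S \<in> C" for S
    using I_level[OF that] I(2) rainbow_finite by blast
  have remove: "S - {e} \<in> C" if S: "S \<in> C" "e \<in> S" for S e
  proof -
    obtain j where j: "card S = Suc j" using S finS by (metis card_Suc_Diff1)
    then have "S - {e} \<in> shadow (I (Suc j))" using I_level[OF S(1)] S(2) by (auto simp: shadow_def)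
    then show ?thesis using shadow_I by (auto simp: C_def)
  qed
  have down: "S' \<in> C" if "S \<in> C" "S' \<subseteq> S" for S S'
  proof -
    have "S - D \<in> C" if "finite D" "D \<subseteq> S" for D
      using that
    proof (induction D rule: finite_induct)
      case (insert e D)
      have "S - D \<in> C" "e \<in> S - D" using insert by blast+
      then have "S - D - {e} \<in> C" by (rule remove)
      moreover have "S - insert e D = S - D - {e}" by blast
      ultimately show ?case by metis
    next
      case empty
      show ?case using \<open>S \<in> C\<close> by simp
    qed
    from this[of "S - S'"] show ?thesis using that finS by (simp add: double_diff)
  qed
  have "abstract_complex W C"
    unfolding abstract_complex_def
  proof (intro conjI ballI allI impI)
    show "finite W" unfolding W_def using finC finS by blast
    show "C \<subseteq> Pow W" by (auto simp: W_def)
    \<comment> \<open>The empty clique is always counted, even for an empty graph.\<close>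
    have "I 0 \<noteq> {}" using card_I[of 0] by auto
    then show "{} \<in> C" using down by (auto simp: C_def)
    show "{v} \<in> C" if "v \<in> W" for v using that down by (auto simp: W_def)
  qed (rule down)
  moreover have "complex_colorable r W C"
    unfolding complex_colorable_def graph_colorable_def
  proof (intro exI conjI ballI impI)
    \<comment> \<open>The residue is the color, and an edge is a rainbow set.\<close>
    show "(\<lambda>v. v mod r) \<in> W \<rightarrow> {..<r}" using \<open>r > 0\<close> by simp
    fix u v assume "{u, v} \<in> skeleton1_edges C"
    then have uv: "{u, v} \<in> C" "card {u, v} = 2" by (auto simp: skeleton1_edges_def)
    then have "{u, v} \<in> ?X 2" using I_level[of "{u, v}"] I(2)[of 2] by auto
    moreover have "u \<noteq> v" using uv by auto
    ultimately show "u mod r \<noteq> v mod r" using rainbow_unique by blast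
  qed
  moreover have "face_count i C = clique_count i V E" for i
  proof -
    have "{F \<in> C. card F = i} = I i"
      using I_level I(2)[of i] rainbow_card by (auto simp: C_def)
    then show ?thesis by (simp add: face_count_def card_I)
  qed
  ultimately show ?thesis by blast
qed

end
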